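(* Let $0<\lambda<\tfrac12$, let $F_\lambda$ be the middle-$(1-2\lambda)$ Cantor set, let $F_\lambda^2=\{x^2:x\in F_\lambda\}$, and let $$D=\left\{\frac{x_1^2}{x_2}: x_1,x_2\in F_\lambda,\ x_2\neq 0\right\},\qquad K=\{k\ge 0: k\notin D\}.$$ Then: (i) $F_\lambda^2$ is not a self-similar set; (ii) if $\tfrac13\le\lambda<\tfrac12$, then $K=\emptyset$, i.e. $D=[0,+\infty)$; (iii) if $\tfrac{2-\sqrt2}{2}\le\lambda<\tfrac12$, then $D$ contains a closed interval of positive length.
   Context: For $0<\lambda<\tfrac12$, $F_\lambda\subset[0,1]$ is the unique nonempty compact set (attractor) satisfying $F_\lambda=f_0(F_\lambda)\cup f_1(F_\lambda)$, where $f_0(x)=\lambda x$ and $f_1(x)=\lambda x+(1-\lambda)$. A compact set $E\subset\mathbb R$ is self-similar if it is the attractor of a finite family (with at least two maps) of contracting similarities $x\mapsto r_ix+b_i$, $0<|r_i|<1$. The set $K$ is the set of slopes $k\ge 0$ for which the ray $y=kx$, $x>0$, does not meet $F_\lambda\times F_\lambda^2$. *)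

theory Defs
  imports "HOL-Analysis.Analysis"
begin

definition f0 :: "real \<Rightarrow> real \<Rightarrow> real" where
  "f0 lam x = lam * x"

definition f1 :: "real \<Rightarrow> real \<Rightarrow> real" where
  "f1 lam x = lam * x + (1 - lam)"

definition cantor :: "real \<Rightarrow> real set" where
  "cantor lam = (THE F. compact F \<and> F \<noteq> {} \<and> F = f0 lam ` F \<union> f1 lam ` F)"

definition self_similar :: "real set \<Rightarrow> bool" where
  "self_similar E \<longleftrightarrow> compact E \<and> E \<noteq> {} \<and>
     (\<exists>S :: (real \<times> real) set. finite S \<and> card S \<ge> 2 \<and>
        (\<forall>(r, b) \<in> S. 0 < \<bar>r\<bar> \<and> \<bar>r\<bar> < 1) \<and>
        E = (\<Union>(r, b) \<in> S. (\<lambda>x. r * x + b) ` E))"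

definition quotset :: "real \<Rightarrow> real set" where
  "quotset lam = {x1^2 / x2 | x1 x2. x1 \<in> cantor lam \<and> x2 \<in> cantor lam \<and> x2 \<noteq> 0}"

definition Kset :: "real \<Rightarrow> real set" where
  "Kset lam = {k. k \<ge> 0 \<and> k \<notin> quotset lam}"

end

theory Submission
  imports Defs
begin

text \<open>
  Write \<open>F\<close> for the Cantor set and \<open>\<mu> = 1 - 2\<lambda>\<close> for the length of its central gap.

  (i) Suppose that \<open>r F\<^sup>2 + b\<close> lies in \<open>Q(F)\<close> with \<open>Q(x) = C + A x + B x\<^sup>2\<close>, \<open>A \<ge> 0\<close>, \<open>B > 0\<close>,
  and meets both \<open>Q(\<lambda>F)\<close> and \<open>Q(\<lambda>F + 1 - \<lambda>)\<close>. The central gap of \<open>Q(F)\<close> has length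
  \<open>\<mu>(A + B)\<close> and must be covered by a gap of \<open>r F\<^sup>2 + b\<close>; the largest gap of \<open>F\<^sup>2\<close> is the central
  one, of length \<open>\<mu>\<close>, and \<open>\<bar>r\<bar> \<le> A + B\<close> by comparing diameters. So \<open>\<bar>r\<bar> = A + B\<close>, both hulls
  and both central gaps agree, and this forces \<open>A = 0\<close>. If \<open>F\<^sup>2\<close> were self-similar, the
  piece containing 1 would either meet both halves of \<open>F\<^sup>2\<close>, so that its ratio is 1, or lie in the
  right half, where \<open>A > 0\<close> in every cell; passing to the smallest cell containing it gives
  a contradiction in both cases.

  (ii), (iii) If \<open>k\<close> lies in \<open>{x\<^sup>2 / y | x \<in> I, y \<in> J}\<close> for the hulls \<open>I\<close>, \<open>J\<close> of two cells of the same level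
  in \<open>[c, 1]\<close>, where \<open>c \<ge> 2\<mu>\<close> and \<open>2\<lambda>c \<ge> \<mu>\<close>, then the same holds for one of the four pairs of
  subcells, because their ranges overlap consecutively. Hence \<open>k \<in> D\<close> by compactness.
  Take \<open>c = 1 - \<lambda>\<close> for (ii), where invariance of \<open>D\<close> under multiplication by \<open>\<lambda>\<close> and \<open>1/\<lambda>\<close> does
  the rest, and \<open>c = 1 - \<lambda>\<^sup>2\<close> for (iii).
\<close>

section \<open>The Cantor set\<close>

text \<open>This is the predicate described inside \<open>cantor\<close>, named so that its
  solutions can be studied before existence and uniqueness are known.\<close>

definition cantor_like :: "real \<Rightarrow> real set \<Rightarrow> bool" where
  "cantor_like lam F \<longleftrightarrow> compact F \<and> F \<noteq> {} \<and> F = f0 lam ` F \<union> f1 lam ` F"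

locale cantor_ratio =
  fixes lam :: real
  assumes lam_pos: "0 < lam" and lam_less_half: "lam < 1/2"
begin

lemma cantor_like_maps:
  assumes "cantor_like lam F" "x \<in> F"
  shows "lam * x \<in> F" "lam * x + (1 - lam) \<in> F"
proof -
  have "f0 lam x \<in> F" "f1 lam x \<in> F"
    using assms unfolding cantor_like_def by blast+
  then show "lam * x \<in> F" "lam * x + (1 - lam) \<in> F"
    by (simp_all add: f0_def f1_def)
qed

lemma cantor_like_cases:
  assumes "cantor_like lam F" "x \<in> F"
  obtains y where "y \<in> F" "x = lam * y" | y where "y \<in> F" "x = lam * y + (1 - lam)"
proof -
  have "x \<in> f0 lam ` F \<union> f1 lam ` F"
    using assms unfolding cantor_like_def by blast
  then show ?thesis
    using that by (auto simp: f0_def f1_def)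
qed

text \<open>The least point \<open>m\<close> has \<open>lam * m\<close> in the set, so
  \<open>m <= lam * m\<close> and \<open>m <= 0\<close>. Conversely \<open>m\<close> is an image of
  some point that is at least \<open>m\<close>, which gives \<open>m >= 0\<close>.\<close>

lemma cantor_like_min:
  assumes F: "cantor_like lam F"
  shows "0 \<in> F" "\<And>x. x \<in> F \<Longrightarrow> 0 \<le> x"
proof -
  obtain m where m: "m \<in> F" "\<And>x. x \<in> F \<Longrightarrow> m \<le> x"
    using F compact_attains_inf[of F] unfolding cantor_like_def by blast
  have "m \<le> lam * m"
    using cantor_like_maps(1)[OF F m(1)] m(2) by blast
  then have "(1 - lam) * m \<le> 0" by (simp add: algebra_simps)
  then have "m \<le> 0"
    using lam_less_half by (simp add: mult_le_0_iff)
  have "(1 - lam) * m \<ge> 0"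
    using F m(1)
  proof (cases rule: cantor_like_cases)
    case (1 y)
    then show ?thesis
      using mult_left_mono[OF m(2)[OF 1(1)], of lam] lam_pos by (simp add: algebra_simps)
  next
    case (2 y)
    then have "lam * m + (1 - lam) \<le> m"
      using mult_left_mono[OF m(2)[OF 2(1)], of lam] lam_pos by simp
    then show ?thesis
      using lam_less_half by (simp add: algebra_simps)
  qed
  then have "0 \<le> m"
    using lam_less_half by (simp add: zero_le_mult_iff)
  with \<open>m \<le> 0\<close> m show "0 \<in> F" "\<And>x. x \<in> F \<Longrightarrow> 0 \<le> x" by force+
qed

lemma cantor_like_max:
  assumes F: "cantor_like lam F"
  shows "1 \<in> F" "\<And>x. x \<in> F \<Longrightarrow> x \<le> 1"
proof -
  obtain m where m: "m \<in> F" "\<And>x. x \<in> F \<Longrightarrow> x \<le> m"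
    using F compact_attains_sup[of F] unfolding cantor_like_def by blast
  have "lam * m + (1 - lam) \<le> m"
    using cantor_like_maps(2)[OF F m(1)] m(2) by blast
  then have "0 \<le> (1 - lam) * (m - 1)" by (simp add: algebra_simps)
  then have "1 \<le> m"
    using lam_less_half by (simp add: zero_le_mult_iff)
  have "(1 - lam) * (m - 1) \<le> 0"
    using F m(1)
  proof (cases rule: cantor_like_cases)
    case (1 y)
    then have "m \<le> lam * m"
      using mult_left_mono[OF m(2)[OF 1(1)], of lam] lam_pos by simp
    then show ?thesis
      using lam_less_half by (simp add: algebra_simps)
  next
    case (2 y)
    then show ?thesis
      using mult_left_mono[OF m(2)[OF 2(1)], of lam] lam_pos by (simp add: algebra_simps)
  qed
  then have "m \<le> 1"
    using lam_less_half by (simp add: mult_le_0_iff)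
  with \<open>1 \<le> m\<close> m show "1 \<in> F" "\<And>x. x \<in> F \<Longrightarrow> x \<le> 1" by force+
qed

section \<open>Uniqueness and existence of the attractor\<close>

lemma lam_power_tendsto_0: "(\<lambda>n. lam ^ n) \<longlonglongrightarrow> 0"
  using lam_pos lam_less_half by (intro LIMSEQ_power_zero) auto

lemma ex_lam_power_less:
  assumes "0 < e"
  shows "\<exists>n. lam ^ n < e"
  using real_arch_pow_inv[OF assms] lam_less_half by auto

text \<open>Following the first \<open>n\<close> digits of the address of \<open>x\<close> inside
  \<open>G\<close> leads to a point within \<open>lam ^ n\<close>. Applied in both directions, this
  yields uniqueness.\<close>

lemma cantor_like_approx:
  assumes F: "cantor_like lam F" and G: "cantor_like lam G" and "x \<in> F"
  shows "\<exists>y\<in>G. \<bar>x - y\<bar> \<le> lam ^ n"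
  using \<open>x \<in> F\<close>
proof (induction n arbitrary: x)
  case 0
  then have "\<bar>x - 0\<bar> \<le> lam ^ 0"
    using cantor_like_min(2)[OF F] cantor_like_max(2)[OF F] by simp
  then show ?case
    using cantor_like_min(1)[OF G] by blast
next
  case (Suc n)
  have scale: "\<bar>(lam * u + d) - (lam * v + d)\<bar> \<le> lam ^ Suc n"
    if "\<bar>u - v\<bar> \<le> lam ^ n" for u v d
    using mult_left_mono[OF that, of lam] lam_pos
    by (simp add: abs_mult flip: right_diff_distrib)
  from F Suc.prems show ?case
  proof (cases rule: cantor_like_cases)
    case (1 u)
    obtain v where v: "v \<in> G" "\<bar>u - v\<bar> \<le> lam ^ n" using Suc.IH[OF 1(1)] by blast
    then show ?thesis
      using scale[OF v(2), of 0] 1(2) cantor_like_maps(1)[OF G v(1)] by auto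
  next
    case (2 u)
    obtain v where v: "v \<in> G" "\<bar>u - v\<bar> \<le> lam ^ n" using Suc.IH[OF 2(1)] by blast
    then show ?thesis
      using scale[OF v(2), of "1 - lam"] 2(2) cantor_like_maps(2)[OF G v(1)] by blast
  qed
qed

lemma cantor_like_subset:
  assumes F: "cantor_like lam F" and G: "cantor_like lam G"
  shows "F \<subseteq> G"
proof
  fix x assume "x \<in> F"
  have "\<exists>y\<in>G. dist y x < e" if e: "0 < e" for e
  proof -
    obtain n where n: "lam ^ n < e" using ex_lam_power_less[OF e] ..
    obtain y where "y \<in> G" "\<bar>x - y\<bar> \<le> lam ^ n"
      using cantor_like_approx[OF F G \<open>x \<in> F\<close>] by blast
    with n show ?thesis by (intro bexI[of _ y]) (auto simp: dist_real_def)
  qed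
  then have "x \<in> closure G"
    by (simp add: closure_approachable)
  then show "x \<in> G"
    using G closure_closed[OF compact_imp_closed, of G] unfolding cantor_like_def by blast
qed

text \<open>
  The largest \<open>X \<subseteq> [0,1]\<close> with \<open>X \<subseteq> f0 ` X \<union> f1 ` X\<close> is closed since the closure
  of such an \<open>X\<close> is again of this kind.
\<close>
lemma cantor_like_exists: "\<exists>F. cantor_like lam F"
proof -
  define P where "P X \<longleftrightarrow> X \<subseteq> {0..1} \<and> X \<subseteq> f0 lam ` X \<union> f1 lam ` X" for X
  define F where "F = \<Union>{X. P X}"
  have PF: "P F"
    unfolding F_def P_def by blast
  have greatest: "X \<subseteq> F" if "P X" for X
    using that by (auto simp: F_def)
  have cont: "continuous_on S (f0 lam)" "continuous_on S (f1 lam)" for S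
    unfolding f0_def f1_def by (intro continuous_intros)+
  have sub01: "f0 lam ` {0..1} \<union> f1 lam ` {0..1} \<subseteq> {0..1}"
  proof -
    have "0 \<le> lam * x \<and> lam * x \<le> lam" if "x \<in> {0..1}" for x
      using that lam_pos by (simp add: mult_left_le)
    then show ?thesis
      using lam_less_half unfolding f0_def f1_def by fastforce
  qed
  have cl01: "closure F \<subseteq> {0..1}"
    using PF closure_minimal[of F "{0..1}"] by (simp add: P_def)
  then have comp: "compact (closure F)"
    using bounded_subset[of "{0..1::real}"] by (simp add: compact_eq_bounded_closed)
  have "closed (f0 lam ` closure F \<union> f1 lam ` closure F)"
    using compact_continuous_image[OF cont(1) comp] compact_continuous_image[OF cont(2) comp]
    by (intro closed_Un compact_imp_closed)
  moreover have "F \<subseteq> f0 lam ` closure F \<union> f1 lam ` closure F"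
    using PF closure_subset[of F] unfolding P_def by blast
  ultimately have "closure F \<subseteq> f0 lam ` closure F \<union> f1 lam ` closure F"
    by (simp add: closure_minimal)
  then have "closure F \<subseteq> F"
    using cl01 by (intro greatest) (simp add: P_def)
  then have "closure F = F"
    using closure_subset[of F] by blast
  with comp have "compact F" by simp
  moreover have "P {0}"
    by (simp add: P_def f0_def)
  then have "F \<noteq> {}" using greatest by blast
  \<comment> \<open>As in the Knaster-Tarski argument, the image of the greatest such set has
    property \<open>P\<close> again and is therefore contained in it; this is the missing
    inclusion.\<close>
  moreover have "P (f0 lam ` F \<union> f1 lam ` F)"
    unfolding P_def
  proof
    show "f0 lam ` F \<union> f1 lam ` F \<subseteq> {0..1}"
      using PF sub01 unfolding P_def by blast
    show "f0 lam ` F \<union> f1 lam ` F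
      \<subseteq> f0 lam ` (f0 lam ` F \<union> f1 lam ` F) \<union> f1 lam ` (f0 lam ` F \<union> f1 lam ` F)"
      using PF unfolding P_def by blast
  qed
  then have "f0 lam ` F \<union> f1 lam ` F \<subseteq> F"
    by (rule greatest)
  then have "F = f0 lam ` F \<union> f1 lam ` F"
    using PF by (simp add: P_def subset_antisym)
  ultimately show ?thesis
    unfolding cantor_like_def by blast
qed

section \<open>Basic facts about the attractor\<close>

abbreviation F :: "real set" where "F \<equiv> cantor lam"

lemma cantor_like_cantor: "cantor_like lam F"
proof -
  have "\<exists>!F. cantor_like lam F"
    using cantor_like_exists cantor_like_subset by (metis subset_antisym)
  then have "cantor_like lam (THE F. cantor_like lam F)" by (rule theI')
  then show ?thesis
    unfolding cantor_def cantor_like_def .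
qed

lemmas F_lower = cantor_like_maps(1)[OF cantor_like_cantor]
  and F_upper = cantor_like_maps(2)[OF cantor_like_cantor]
  and zero_in_F = cantor_like_min(1)[OF cantor_like_cantor]
  and F_nonneg = cantor_like_min(2)[OF cantor_like_cantor]
  and one_in_F = cantor_like_max(1)[OF cantor_like_cantor]
  and F_le_one = cantor_like_max(2)[OF cantor_like_cantor]

lemma F_cases:
  assumes "x \<in> F"
  obtains y where "y \<in> F" "x = lam * y" | y where "y \<in> F" "x = lam * y + (1 - lam)"
  using cantor_like_cantor assms by (rule cantor_like_cases)

lemma compact_F: "compact F"
  using cantor_like_cantor unfolding cantor_like_def by blast

lemma lam_in_F: "lam \<in> F" and one_minus_lam_in_F: "1 - lam \<in> F"
  using F_lower[OF one_in_F] F_upper[OF zero_in_F] by simp_all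

lemma lower_le:
  assumes "x \<in> F"
  shows "lam * x \<le> lam"
  using F_le_one[OF assms] lam_pos by (simp add: mult_left_le)

lemma upper_ge:
  assumes "x \<in> F"
  shows "1 - lam \<le> lam * x + (1 - lam)"
  using F_nonneg[OF assms] lam_pos by simp

section \<open>Gaps of the Cantor set and of its square\<close>

definition gap :: "real \<Rightarrow> real \<Rightarrow> bool" where
  "gap s t \<longleftrightarrow> s \<in> F \<and> t \<in> F \<and> s < t \<and> (\<forall>x\<in>F. x \<le> s \<or> t \<le> x)"

text \<open>Endpoints in the same half are rescaled to a gap one level up. If they lie in different
  halves, the points \<open>lam\<close> and \<open>1 - lam\<close> of \<open>F\<close> cannot lie
  strictly between them, which fixes both.\<close>

lemma gap_cases:
  assumes "gap s t"
  obtains "s = lam" "t = 1 - lam"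
  | s' t' d where "gap s' t'" "s = lam * s' + d" "t = lam * t' + d"
proof -
  have st: "s \<in> F" "t \<in> F" "s < t" and between: "\<And>x. x \<in> F \<Longrightarrow> x \<le> s \<or> t \<le> x"
    using assms by (auto simp: gap_def)
  have scaled: "gap s' t'"
    if "s' \<in> F" "t' \<in> F" "s = lam * s' + d" "t = lam * t' + d"
      "\<And>x. x \<in> F \<Longrightarrow> lam * x + d \<in> F" for s' t' d
    unfolding gap_def
  proof (intro conjI ballI)
    show "s' \<in> F" "t' \<in> F" using that by auto
    show "s' < t'" using that st lam_pos by auto
    fix x assume "x \<in> F"
    then have "lam * x + d \<le> s \<or> t \<le> lam * x + d" using between that by blast
    then show "x \<le> s' \<or> t' \<le> x" using that lam_pos by simp
  qed
  show ?thesis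
    using st(1)
  proof (cases rule: F_cases)
    case s: (1 s')
    show ?thesis
      using st(2)
    proof (cases rule: F_cases)
      case (1 t')
      then show ?thesis using s scaled[of s' t' 0] F_lower that(2)[of s' t' 0] by simp
    next
      case (2 t')
      have "lam \<le> s \<or> t \<le> lam" "1 - lam \<le> s \<or> t \<le> 1 - lam"
        using between lam_in_F one_minus_lam_in_F by blast+
      then show ?thesis
        using that(1) lower_le[OF s(1)] upper_ge[OF 2(1)] s 2 lam_less_half by auto
    qed
  next
    case s: (2 s')
    show ?thesis
      using st(2)
    proof (cases rule: F_cases)
      case (1 t')
      then show ?thesis using lower_le[OF 1(1)] upper_ge[OF s(1)] s st lam_less_half by auto
    next
      case (2 t')
      then show ?thesis
        using s scaled[of s' t' "1 - lam"] F_upper that(2)[of s' t' "1 - lam"] by simp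
    qed
  qed
qed

lemma gap_length_le:
  assumes "gap s t"
  shows "t - s \<le> 1 - 2 * lam"
proof -
  \<comment> \<open>A gap may lie arbitrarily deep, so the induction is on the number of rescalings.
    The error \<open>lam ^ n\<close> covers the start, where only \<open>t - s <= 1\<close> is
    known, and vanishes in the limit.\<close>
  have "t - s \<le> 1 - 2 * lam + lam ^ n" for n
    using assms
  proof (induction n arbitrary: s t)
    case 0
    then have "0 \<le> s" "t \<le> 1" by (auto simp: gap_def F_nonneg F_le_one)
    then show ?case using lam_less_half by simp
  next
    case (Suc n)
    from Suc.prems show ?case
    proof (cases rule: gap_cases)
      case 1
      then show ?thesis using lam_pos by simp
    next
      case (2 s' t' d)
      have "t - s = lam * (t' - s')" using 2 by (simp add: algebra_simps)
      also have "\<dots> \<le> lam * (1 - 2 * lam + lam ^ n)"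
        using Suc.IH[OF 2(1)] lam_pos by simp
      also have "\<dots> \<le> 1 - 2 * lam + lam ^ Suc n"
        using mult_right_mono[of lam 1 "1 - 2 * lam"] lam_less_half by (simp add: algebra_simps)
      finally show ?thesis .
    qed
  qed
  then have "t - s \<le> 1 - 2 * lam + 0"
    by (intro LIMSEQ_le_const[OF tendsto_add[OF tendsto_const lam_power_tendsto_0]]) auto
  then show ?thesis by simp
qed

text \<open>A gap other than the central one has length at most \<open>lam * (1 - 2 * lam)\<close>.
  Squaring multiplies this by \<open>t + s <= 2\<close>, and \<open>2 * lam < 1\<close>.\<close>

lemma gap_square_large:
  assumes "gap s t" "1 - 2 * lam \<le> t^2 - s^2"
  shows "s = lam \<and> t = 1 - lam"
  using assms(1)
proof (cases rule: gap_cases)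
  case (2 s' t' d)
  have st: "0 \<le> s" "s < t" "t \<le> 1" using assms(1) by (auto simp: gap_def F_nonneg F_le_one)
  have "t - s = lam * (t' - s')" using 2 by (simp add: algebra_simps)
  also have "\<dots> \<le> lam * (1 - 2 * lam)"
    using gap_length_le[OF 2(1)] lam_pos by simp
  finally have "t - s \<le> lam * (1 - 2 * lam)" .
  then have "(t - s) * (t + s) \<le> lam * (1 - 2 * lam) * 2"
    using st lam_pos lam_less_half by (intro mult_mono) auto
  also have "\<dots> < 1 - 2 * lam"
    using mult_strict_right_mono[of "2 * lam" 1 "1 - 2 * lam"] lam_less_half
    by (simp add: algebra_simps)
  finally show ?thesis using assms(2) by (simp add: power2_eq_square algebra_simps)
qed simp

lemma gap_between:
  assumes UV: "U \<union> V = F" "closed U" "closed V" "U \<noteq> {}" "V \<noteq> {}"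
    and less: "\<And>u v. u \<in> U \<Longrightarrow> v \<in> V \<Longrightarrow> u < v"
  obtains s t where "s \<in> U" "t \<in> V" "gap s t"
proof -
  have "U = F \<inter> U" "V = F \<inter> V" using UV(1) by auto
  then have "compact U" "compact V"
    using compact_F UV(2,3) compact_Int_closed by metis+
  then obtain s t where s: "s \<in> U" "\<And>u. u \<in> U \<Longrightarrow> u \<le> s"
    and t: "t \<in> V" "\<And>v. v \<in> V \<Longrightarrow> t \<le> v"
    using compact_attains_sup[of U] compact_attains_inf[of V] UV(4,5) by metis
  then have "gap s t"
    using less UV(1) unfolding gap_def by blast
  with s t show ?thesis using that by blast
qed

section \<open>The square is not self-similar\<close>

lemma straddling_affine_copy:
  assumes A: "0 \<le> A" and B: "0 < B" and r: "r \<noteq> 0"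
    and sub: "\<And>x. x \<in> F \<Longrightarrow> \<exists>y\<in>F. r * x^2 + b = C + A * y + B * y^2"
    and lo: "u \<in> F" "u' \<in> F" "r * u^2 + b = C + A * (lam * u') + B * (lam * u')^2"
    and hi: "v \<in> F" "v' \<in> F"
      "r * v^2 + b = C + A * (lam * v' + (1 - lam)) + B * (lam * v' + (1 - lam))^2"
  shows "A = 0 \<and> \<bar>r\<bar> = A + B"
proof -
  define Q where "Q y = C + A * y + B * y^2" for y
  define p where "p x = r * x^2 + b" for x
  have Q_mono: "Q y \<le> Q z" if "0 \<le> y" "y \<le> z" for y z
    unfolding Q_def using that A B by (intro add_mono mult_left_mono power_mono) auto
  have Q_gap: "Q (1 - lam) - Q lam = (1 - 2 * lam) * (A + B)"
    by (simp add: Q_def power2_eq_square algebra_simps)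
  have gap_pos: "0 < (1 - 2 * lam) * (A + B)"
    using A B lam_less_half by simp
  have p_in: "\<exists>y\<in>F. p x = Q y" if "x \<in> F" for x
    using sub[OF that] by (simp add: p_def Q_def)
  have p_range: "Q 0 \<le> p x" "p x \<le> Q 1" if "x \<in> F" for x
    using p_in[OF that] Q_mono F_nonneg F_le_one by fastforce+
  \<comment> \<open>\<open>U\<close> and \<open>V\<close> are the points sent below and above the
    central gap of \<open>Q(F)\<close>. The gap of \<open>F\<close> that separates them must have an
    image under \<open>p\<close> covering that central gap.\<close>
  define U where "U = F \<inter> {x. p x \<le> Q lam}"
  define V where "V = F \<inter> {x. Q (1 - lam) \<le> p x}"
  have UV: "U \<union> V = F"
  proof -
    have "p x \<le> Q lam \<or> Q (1 - lam) \<le> p x" if x: "x \<in> F" for x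
    proof -
      obtain y where y: "y \<in> F" "p x = Q y" using p_in[OF x] by blast
      from y(1) show ?thesis
      proof (cases rule: F_cases)
        case (1 z)
        then show ?thesis using y Q_mono[of y lam] lower_le[of z] F_nonneg[of y] by auto
      next
        case (2 z)
        then show ?thesis
          using y Q_mono[of "1 - lam" y] upper_ge[of z] lam_less_half by auto
      qed
    qed
    then show ?thesis by (auto simp: U_def V_def)
  qed
  have cont: "continuous_on UNIV p"
    unfolding p_def by (intro continuous_intros)
  have "closed {x. p x \<le> Q lam}" "closed {x. Q (1 - lam) \<le> p x}"
    using cont by (auto intro!: closed_Collect_le continuous_on_const)
  then have cl: "closed U" "closed V"
    unfolding U_def V_def using compact_F by (auto intro: compact_imp_closed closed_Int)
  have "u \<in> U"
    using lo Q_mono[of "lam * u'" lam] lower_le[of u'] F_nonneg[of u'] lam_pos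
    by (auto simp: U_def p_def Q_def)
  moreover have "v \<in> V"
    using hi Q_mono[of "1 - lam" "lam * v' + (1 - lam)"] upper_ge[of v'] lam_less_half
    by (auto simp: V_def p_def Q_def)
  ultimately have ne: "U \<noteq> {}" "V \<noteq> {}" by auto
  have UV_less: "p x < p y" if "x \<in> U" "y \<in> V" for x y
    using that Q_gap gap_pos by (auto simp: U_def V_def)
  have ends: "Q 0 \<le> b" "b \<le> Q 1" "Q 0 \<le> r + b" "r + b \<le> Q 1"
    using p_range[OF zero_in_F] p_range[OF one_in_F] by (auto simp: p_def)
  have Q01: "Q 0 = C" "Q 1 = C + A + B" by (simp_all add: Q_def)
  have mu: "0 < 1 - 2 * lam" using lam_less_half by simp
  show ?thesis
  proof (cases "0 < r")
    case True
    have "x < y" if "x \<in> U" "y \<in> V" for x y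
    proof -
      have "x^2 < y^2" using UV_less[OF that] True by (simp add: p_def)
      then show ?thesis using that F_nonneg[of y] power2_less_imp_less by (auto simp: V_def)
    qed
    then obtain s t where st: "s \<in> U" "t \<in> V" "gap s t"
      using gap_between[OF UV cl ne] by blast
    have rle: "r \<le> A + B" using ends Q01 by linarith
    have "(1 - 2 * lam) * (A + B) \<le> p t - p s"
      using st Q_gap by (auto simp: U_def V_def)
    also have "\<dots> = r * (t^2 - s^2)" by (simp add: p_def algebra_simps)
    finally have *: "(1 - 2 * lam) * (A + B) \<le> r * (t^2 - s^2)" .
    also have "\<dots> \<le> (A + B) * (t^2 - s^2)"
      using rle st(3) F_nonneg[of s] by (intro mult_right_mono) (auto simp: gap_def power_mono)
    finally have "1 - 2 * lam \<le> t^2 - s^2" using A B by (simp add: mult.commute)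
    then have s: "s = lam" "t = 1 - lam" using gap_square_large[OF st(3)] by auto
    have "t^2 - s^2 = 1 - 2 * lam"
      unfolding s by (simp add: power2_eq_square algebra_simps)
    then have "A + B \<le> r"
      using * mu by (simp add: mult.commute)
    then have rAB: "r = A + B" "b = C" using rle ends Q01 by auto
    \<comment> \<open>Now \<open>p t = C + (A + B) * t^2\<close>, and comparison with
      \<open>Q t\<close> leaves \<open>A * t <= A * t^2\<close> with
      \<open>0 < t < 1\<close>.\<close>
    have "Q t \<le> p t" using st s by (simp add: V_def)
    then have "A * t \<le> A * t^2" by (simp add: p_def Q_def rAB algebra_simps)
    moreover have "t^2 < t" using s lam_pos lam_less_half by (simp add: power2_eq_square)
    ultimately have "A = 0" using A mult_strict_left_mono[of "t^2" t A] by fastforce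
    then show ?thesis using rAB B by simp
  next
    \<comment> \<open>A negative ratio reverses the order, so \<open>V\<close> lies to the left of
      \<open>U\<close>.\<close>
    case False
    then have rneg: "r < 0" using r by simp
    have "y < x" if "x \<in> U" "y \<in> V" for x y
    proof -
      have "y^2 < x^2" using UV_less[OF that] rneg by (simp add: p_def)
      then show ?thesis using that F_nonneg[of x] power2_less_imp_less by (auto simp: U_def)
    qed
    then obtain s t where st: "s \<in> V" "t \<in> U" "gap s t"
      using gap_between[of V U] UV cl ne by (metis sup_commute)
    have rle: "- r \<le> A + B" using ends Q01 by linarith
    have "(1 - 2 * lam) * (A + B) \<le> p s - p t"
      using st Q_gap by (auto simp: U_def V_def)
    also have "\<dots> = - r * (t^2 - s^2)" by (simp add: p_def algebra_simps)
    finally have *: "(1 - 2 * lam) * (A + B) \<le> - r * (t^2 - s^2)" .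
    also have "\<dots> \<le> (A + B) * (t^2 - s^2)"
      using rle st(3) F_nonneg[of s] by (intro mult_right_mono) (auto simp: gap_def power_mono)
    finally have "1 - 2 * lam \<le> t^2 - s^2" using A B by (simp add: mult.commute)
    then have s: "s = lam" "t = 1 - lam" using gap_square_large[OF st(3)] by auto
    have "t^2 - s^2 = 1 - 2 * lam"
      unfolding s by (simp add: power2_eq_square algebra_simps)
    then have "(1 - 2 * lam) * (A + B) \<le> (1 - 2 * lam) * (- r)"
      using * by (metis mult.commute)
    then have "A + B \<le> - r" using mu mult_le_cancel_left_pos by blast
    then have rAB: "r = - (A + B)" "b = C + A + B" using rle ends Q01 by auto
    \<comment> \<open>With the hulls matched in reverse, the central gaps cannot match: the
      difference \<open>p t - Q lam\<close> is
      \<open>(A + 2 * B) * (lam - lam^2) > 0\<close>.\<close>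
    have "p t \<le> Q lam" using st by (simp add: U_def)
    then have "A * (lam - lam^2) + 2 * B * (lam - lam^2) \<le> 0"
      by (simp add: p_def Q_def rAB s power2_eq_square algebra_simps)
    moreover have "0 < lam - lam^2" using lam_pos lam_less_half by (simp add: power2_eq_square)
    then have "0 \<le> A * (lam - lam^2)" "0 < 2 * B * (lam - lam^2)" using A B by simp_all
    ultimately show ?thesis by linarith
  qed
qed

lemma affine_copy_halves:
  assumes A: "0 \<le> A" and B: "0 < B" and r: "r \<noteq> 0"
    and sub: "\<And>x. x \<in> F \<Longrightarrow> \<exists>y\<in>F. r * x^2 + b = C + A * y + B * y^2"
  shows "(A = 0 \<and> \<bar>r\<bar> = A + B)
    \<or> (\<forall>x\<in>F. \<exists>y\<in>F. r * x^2 + b = C + A * (lam * y) + B * (lam * y)^2)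
    \<or> (\<forall>x\<in>F. \<exists>y\<in>F. r * x^2 + b
        = C + A * (lam * y + (1 - lam)) + B * (lam * y + (1 - lam))^2)"
proof -
  define L where "L x \<longleftrightarrow> (\<exists>y\<in>F. r * x^2 + b = C + A * (lam * y) + B * (lam * y)^2)" for x
  define R where "R x \<longleftrightarrow> (\<exists>y\<in>F. r * x^2 + b
        = C + A * (lam * y + (1 - lam)) + B * (lam * y + (1 - lam))^2)" for x
  have LR: "L x \<or> R x" if x: "x \<in> F" for x
  proof -
    obtain y where y: "y \<in> F" "r * x^2 + b = C + A * y + B * y^2" using sub[OF x] by blast
    from y(1) show ?thesis
      by (cases rule: F_cases) (use y(2) in \<open>auto simp: L_def R_def\<close>)
  qed
  show ?thesis
  proof (cases "(\<exists>x\<in>F. L x) \<and> (\<exists>x\<in>F. R x)")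
    case True
    then have "A = 0 \<and> \<bar>r\<bar> = A + B"
      unfolding L_def R_def using straddling_affine_copy[OF A B r sub] by blast
    then show ?thesis by blast
  next
    case False
    then have "(\<forall>x\<in>F. L x) \<or> (\<forall>x\<in>F. R x)" using LR by blast
    then show ?thesis unfolding L_def R_def by blast
  qed
qed

text \<open>Infinite descent. Since \<open>A > 0\<close> rules out straddling, the copy lies in one
  half, where the new linear coefficient is again positive. The enclosing cells shrink geometrically
  while the copy keeps its size.\<close>

lemma no_affine_copy:
  assumes "0 < A" "0 < B" "r \<noteq> 0"
    and "\<And>x. x \<in> F \<Longrightarrow> \<exists>y\<in>F. r * x^2 + b = C + A * y + B * y^2"
  shows False
proof -
  have small: "\<bar>r\<bar> \<le> A + B"
    if "0 < A" "0 < B"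
      and sub: "\<And>x. x \<in> F \<Longrightarrow> \<exists>y\<in>F. r * x^2 + b = C + A * y + B * y^2" for A B C
  proof -
    have range: "C \<le> C + A * y + B * y^2" "C + A * y + B * y^2 \<le> C + A + B" if "y \<in> F" for y
    proof -
      have "0 \<le> y" "y \<le> 1" using that F_nonneg F_le_one by auto
      then have "A * y \<le> A * 1" "B * y^2 \<le> B * 1" "0 \<le> A * y" "0 \<le> B * y^2"
        using \<open>0 < A\<close> \<open>0 < B\<close> by (auto intro!: mult_left_mono simp: power_le_one)
      then show "C \<le> C + A * y + B * y^2" "C + A * y + B * y^2 \<le> C + A + B" by auto
    qed
    obtain y z where "y \<in> F" "b = C + A * y + B * y^2" "z \<in> F" "r + b = C + A * z + B * z^2"
      using sub[OF zero_in_F] sub[OF one_in_F] by auto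
    then show ?thesis using range[of y] range[of z] by linarith
  qed
  \<comment> \<open>\<open>A + 2 * B\<close> is the derivative of the quadratic at 1. Passing to a
    half multiplies it by at most \<open>lam\<close>, and by exactly \<open>lam\<close> for the
    right half; the diameter \<open>A + B\<close> lacks this property.\<close>
  have "False" if "A + 2 * B < \<bar>r\<bar> / lam ^ n" "0 < A" "0 < B"
    "\<And>x. x \<in> F \<Longrightarrow> \<exists>y\<in>F. r * x^2 + b = C + A * y + B * y^2" for n A B C
    using that
  proof (induction n arbitrary: A B C)
    case 0
    then show ?case using small[OF 0(2-4)] by simp
  next
    case (Suc n)
    have bound: "lam * (A + 2 * B) < \<bar>r\<bar> / lam ^ n"
      using Suc.prems(1) lam_pos by (simp add: field_simps)
    from affine_copy_halves[OF less_imp_le[OF Suc.prems(2)] Suc.prems(3) \<open>r \<noteq> 0\<close> Suc.prems(4)]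
    consider "A = 0"
      | "\<forall>x\<in>F. \<exists>y\<in>F. r * x^2 + b = C + A * (lam * y) + B * (lam * y)^2"
      | "\<forall>x\<in>F. \<exists>y\<in>F. r * x^2 + b
          = C + A * (lam * y + (1 - lam)) + B * (lam * y + (1 - lam))^2"
      by blast
    then show ?case
    proof cases
      case 1
      then show ?thesis using Suc.prems(2) by simp
    next
      case 2
      have "lam * A + 2 * (lam^2 * B) \<le> lam * (A + 2 * B)"
        using lam_pos lam_less_half Suc.prems(3)
        by (simp add: power2_eq_square algebra_simps mult_left_le_one_le)
      then have "lam * A + 2 * (lam^2 * B) < \<bar>r\<bar> / lam ^ n" using bound by linarith
      moreover have "0 < lam * A" "0 < lam^2 * B" using lam_pos Suc.prems(2,3) by simp_all
      moreover have "\<exists>y\<in>F. r * x^2 + b = C + lam * A * y + lam^2 * B * y^2" if "x \<in> F" for x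
        using bspec[OF 2 that] by (simp add: power_mult_distrib algebra_simps)
      ultimately show ?thesis by (rule Suc.IH)
    next
      case 3
      let ?A = "lam * (A + 2 * B * (1 - lam))"
      have "?A + 2 * (lam^2 * B) = lam * (A + 2 * B)"
        by (simp add: power2_eq_square algebra_simps)
      then have "?A + 2 * (lam^2 * B) < \<bar>r\<bar> / lam ^ n" using bound by linarith
      moreover have "0 < ?A" "0 < lam^2 * B"
        using lam_pos lam_less_half Suc.prems(2,3) by (simp_all add: add_pos_pos)
      moreover have "\<exists>y\<in>F. r * x^2 + b
          = (C + A * (1 - lam) + B * (1 - lam)^2) + ?A * y + lam^2 * B * y^2" if "x \<in> F" for x
        using bspec[OF 3 that] by (simp add: power2_eq_square algebra_simps)
      ultimately show ?thesis by (rule Suc.IH)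
    qed
  qed
  moreover obtain n where "lam ^ n < \<bar>r\<bar> / (A + 2 * B)"
    using ex_lam_power_less[of "\<bar>r\<bar> / (A + 2 * B)"] assms by auto
  then have "A + 2 * B < \<bar>r\<bar> / lam ^ n"
    using assms lam_pos by (simp add: field_simps)
  ultimately show False using assms by blast
qed

lemma square_not_self_similar: "\<not> self_similar ((\<lambda>x. x^2) ` F)"
proof
  assume "self_similar ((\<lambda>x. x^2) ` F)"
  then obtain S :: "(real \<times> real) set" where S: "\<forall>(r, b) \<in> S. 0 < \<bar>r\<bar> \<and> \<bar>r\<bar> < 1"
    and eq: "(\<lambda>x. x^2) ` F = (\<Union>(r, b) \<in> S. (\<lambda>x. r * x + b) ` (\<lambda>x. x^2) ` F)"
    unfolding self_similar_def by blast
  have "1 \<in> (\<lambda>x. x^2) ` F"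
    using one_in_F by (intro image_eqI[of _ _ 1]) auto
  then have "1 \<in> (\<Union>(r, b) \<in> S. (\<lambda>x. r * x + b) ` (\<lambda>x. x^2) ` F)"
    by (simp only: eq[symmetric])
  then obtain r b w where rb: "(r, b) \<in> S" and w: "w \<in> F" "r * w^2 + b = 1"
    by auto
  have r: "r \<noteq> 0" "\<bar>r\<bar> < 1" using S rb by auto
  have sub: "\<exists>y\<in>F. r * x^2 + b = 0 + 0 * y + 1 * y^2" if "x \<in> F" for x
  proof -
    have "r * x^2 + b \<in> (\<Union>(r, b) \<in> S. (\<lambda>x. r * x + b) ` (\<lambda>x. x^2) ` F)"
      using rb that by (intro UN_I[of "(r, b)"]) auto
    then have "r * x^2 + b \<in> (\<lambda>x. x^2) ` F"
      by (simp only: eq[symmetric])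
    then show ?thesis by auto
  qed
  from affine_copy_halves[OF order_refl zero_less_one r(1) sub]
  consider "\<bar>r\<bar> = 1"
    | "\<forall>x\<in>F. \<exists>y\<in>F. r * x^2 + b = (lam * y)^2"
    | "\<forall>x\<in>F. \<exists>y\<in>F. r * x^2 + b = (lam * y + (1 - lam))^2"
    by auto
  then show False
  proof cases
    case 1
    then show ?thesis using r by simp
  next
    case 2
    obtain y where y: "y \<in> F" "1 = (lam * y)^2" using bspec[OF 2 w(1)] w(2) by auto
    then have "lam * y < 1" "0 \<le> lam * y"
      using lower_le[OF y(1)] F_nonneg[OF y(1)] lam_pos lam_less_half by (linarith, simp)
    then have "(lam * y)^2 < 1" by (simp add: power_less_one_iff abs_square_less_1)
    then show ?thesis using y by simp
  next
    \<comment> \<open>Expanding the square in the right half gives the linear coefficient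
      \<open>2 * lam * (1 - lam) > 0\<close>, so the descent applies.\<close>
    case 3
    have "\<exists>y\<in>F. r * x^2 + b = (1 - lam)^2 + (2 * lam * (1 - lam)) * y + lam^2 * y^2"
      if "x \<in> F" for x
      using bspec[OF 3 that] by (simp add: power2_eq_square algebra_simps)
    then show ?thesis
      using no_affine_copy[of "2 * lam * (1 - lam)" "lam^2" r b "(1 - lam)^2"] r(1)
        lam_pos lam_less_half by simp
  qed
qed

section \<open>Intervals of quotients\<close>

definition cell :: "real \<Rightarrow> real \<Rightarrow> bool" where
  "cell a l \<longleftrightarrow> (\<forall>x\<in>F. a + l * x \<in> F)"

lemma cell_sub:
  assumes "cell a l"
  shows "cell a (lam * l)" "cell (a + (1 - lam) * l) (lam * l)"
proof -
  have "a + l * (lam * x) \<in> F" "a + l * (lam * x + (1 - lam)) \<in> F" if "x \<in> F" for x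
    using assms F_lower[OF that] F_upper[OF that] by (auto simp: cell_def)
  then show "cell a (lam * l)" "cell (a + (1 - lam) * l) (lam * l)"
    by (auto simp: cell_def algebra_simps)
qed

lemma cell_left_endpoint: "cell a l \<Longrightarrow> a \<in> F"
  using zero_in_F by (force simp: cell_def)

text \<open>For \<open>b > 0\<close>: \<open>k = x\<^sup>2 / y\<close> for some \<open>x \<in> [a, a + l]\<close> and \<open>y \<in> [b, b + l]\<close>.\<close>
definition hits :: "real \<Rightarrow> real \<Rightarrow> real \<Rightarrow> real \<Rightarrow> bool" where
  "hits k a b l \<longleftrightarrow> a^2 \<le> k * (b + l) \<and> k * b \<le> (a + l)^2"

text \<open>In increasing order the four subranges belong to (left \<open>x\<close>, right
  \<open>y\<close>), (left, left), (right, right), (right, left). The outer two overlaps need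
  \<open>1 - 2 * lam <= 2 * lam * c\<close>, the middle one
  \<open>2 * (1 - 2 * lam) <= c\<close>.\<close>

lemma hits_sub:
  assumes c: "2 * (1 - 2 * lam) \<le> c" "1 - 2 * lam \<le> 2 * lam * c"
    and l: "0 < l" and ab: "c \<le> a" "c \<le> b" "a + l \<le> 1" "b + l \<le> 1"
    and hit: "hits k a b l"
  shows "\<exists>a'\<in>{a, a + (1 - lam) * l}. \<exists>b'\<in>{b, b + (1 - lam) * l}. hits k a' b' (lam * l)"
proof -
  define m where "m = 1 - 2 * lam"
  have m: "0 < m" "m < 1" using lam_pos lam_less_half by (auto simp: m_def)
  have c': "2 * m \<le> c" "m \<le> 2 * lam * c" using c by (auto simp: m_def)
  have pos: "0 < a" "0 < b" using c' ab m by auto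
  have ll: "0 < lam * l" "lam * l < l" "0 < m * l" using l lam_pos lam_less_half m by auto
  have split: "(1 - lam) * l = lam * l + m * l" by (simp add: m_def algebra_simps)
  have full: "l = 2 * (lam * l) + m * l" by (simp add: m_def algebra_simps)
  have b_pos: "0 < b + l" "0 < b + lam * l" "0 < b + (1 - lam) * l"
    using pos ll l by (auto simp: split)
  have frac: "x / y \<le> z / w" if "x * w \<le> z * y" "0 < y" "0 < w" for x y z w :: real
    using that by (simp add: field_simps)
  \<comment> \<open>The ranges of \<open>x\<^sup>2 / y\<close> over two cells with the same \<open>x\<close>-cell and the two \<open>y\<close>-cells overlap.\<close>
  have AC: "u^2 / (b + lam * l) \<le> (u + lam * l)^2 / (b + (1 - lam) * l)"
    if u: "0 < u" "u \<le> 1" for u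
  proof -
    have "m * u \<le> m" using u m by (simp add: mult_left_le)
    also have "m \<le> 2 * lam * c" by (rule c'(2))
    also have "\<dots> \<le> 2 * lam * (b + lam * l)"
      using ab lam_pos ll by (intro mult_left_mono) auto
    finally have "u * l * (m * u) \<le> u * l * (2 * lam * (b + lam * l))"
      using u l by (intro mult_left_mono) auto
    moreover have "0 \<le> (lam * l)^2 * (b + lam * l)" using pos ll by simp
    ultimately have "u^2 * (b + (1 - lam) * l) \<le> (u + lam * l)^2 * (b + lam * l)"
      unfolding split by (simp add: power2_eq_square algebra_simps)
    then show ?thesis using b_pos by (intro frac)
  qed
  \<comment> \<open>This is the middle overlap. With \<open>v = a + lam * l\<close> it reduces to
    \<open>m^2 * b * l <= v * (v - 2 * m * b)\<close>, and \<open>b <= 1 - l\<close> together with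
    \<open>2 * m <= v\<close> bounds the last factor below by \<open>2 * m * l\<close>.\<close>
  have B: "(a + (1 - lam) * l)^2 / (b + l) \<le> (a + lam * l)^2 / b"
  proof -
    define v where "v = a + lam * l"
    have v: "0 < v" "c \<le> v" "2 * m \<le> v" using pos ll ab c' by (auto simp: v_def)
    have "2 * m * b \<le> 2 * m * (1 - l)" using ab m by (intro mult_left_mono) auto
    then have "2 * m * l \<le> v - 2 * m * b" using v by (simp add: algebra_simps)
    then have "v * (2 * m * l) \<le> v * (v - 2 * m * b)" using v by (intro mult_left_mono) auto
    moreover have "m * m * b * l \<le> v * (2 * m * l)"
    proof -
      have "m * b \<le> m" using ab l m by (simp add: mult_left_le)
      also have "m \<le> 2 * v" using v m by simp
      finally have "m * l * (m * b) \<le> m * l * (2 * v)" using ll by (intro mult_left_mono) auto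
      then show ?thesis by (simp add: algebra_simps)
    qed
    ultimately have "m * m * b * l \<le> v * (v - 2 * m * b)" by linarith
    then have "l * (m * m * b * l) \<le> l * (v * (v - 2 * m * b))"
      using l by (intro mult_left_mono) auto
    then have "(v + m * l)^2 * b \<le> v^2 * (b + l)"
      by (simp add: power2_eq_square algebra_simps)
    moreover have "a + (1 - lam) * l = v + m * l" by (simp add: v_def split)
    ultimately show ?thesis using pos b_pos by (intro frac) (simp_all add: v_def add.assoc)
  qed
  have hits_iff: "hits k x y (lam * l) \<longleftrightarrow> x^2 / (y + lam * l) \<le> k \<and> k \<le> (x + lam * l)^2 / y"
    if "0 < y" for x y
    using that ll by (simp add: hits_def field_simps)
  have ends: "z + (1 - lam) * l + lam * l = z + l" for z by (simp add: algebra_simps)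
  have lo: "a^2 / (b + l) \<le> k" and hi: "k \<le> (a + l)^2 / b"
    using hit pos b_pos by (auto simp: hits_def field_simps)
  note A0 = AC[of a] and A1 = AC[of "a + (1 - lam) * l"]
  have a1: "0 < a + (1 - lam) * l" "a + (1 - lam) * l \<le> 1" "0 < a" "a \<le> 1"
    using pos ab ll full by (auto simp: split)
  consider "k \<le> (a + lam * l)^2 / (b + (1 - lam) * l)"
    | "a^2 / (b + lam * l) \<le> k" "k \<le> (a + lam * l)^2 / b"
    | "(a + (1 - lam) * l)^2 / (b + l) \<le> k" "k \<le> (a + l)^2 / (b + (1 - lam) * l)"
    | "(a + (1 - lam) * l)^2 / (b + lam * l) \<le> k"
    using A0[OF a1(3,4)] A1[OF a1(1,2)] B unfolding ends by linarith
  then show ?thesis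
  proof cases
    case 1
    then have "hits k a (b + (1 - lam) * l) (lam * l)"
      using lo b_pos by (subst hits_iff) (auto simp: ends)
    then show ?thesis by blast
  next
    case 2
    then have "hits k a b (lam * l)"
      using pos by (subst hits_iff) auto
    then show ?thesis by blast
  next
    case 3
    then have "hits k (a + (1 - lam) * l) (b + (1 - lam) * l) (lam * l)"
      using b_pos by (subst hits_iff) (auto simp: ends)
    then show ?thesis by blast
  next
    case 4
    then have "hits k (a + (1 - lam) * l) b (lam * l)"
      using hi pos by (subst hits_iff) (auto simp: ends)
    then show ?thesis by blast
  qed
qed

lemma hits_imp_quotset:
  assumes c: "2 * (1 - 2 * lam) \<le> c" "1 - 2 * lam \<le> 2 * lam * c"
    and l: "0 < l" and cells: "cell a l" "cell b l"
    and ab: "c \<le> a" "c \<le> b" "a + l \<le> 1" "b + l \<le> 1"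
    and hit: "hits k a b l"
  shows "k \<in> quotset lam"
proof -
  have c_pos: "0 < c" using c(1) lam_less_half by (simp add: algebra_simps)
  have ex: "\<exists>a b. cell a (lam ^ n * l) \<and> cell b (lam ^ n * l) \<and> c \<le> a \<and> c \<le> b
      \<and> a + lam ^ n * l \<le> 1 \<and> b + lam ^ n * l \<le> 1 \<and> hits k a b (lam ^ n * l)" for n
  proof (induction n)
    case 0
    then show ?case using cells ab hit by auto
  next
    case (Suc n)
    define d where "d = lam ^ n * l"
    have d: "0 < d" using l lam_pos by (simp add: d_def)
    obtain a b where IH: "cell a d" "cell b d" "c \<le> a" "c \<le> b" "a + d \<le> 1" "b + d \<le> 1"
      "hits k a b d"
      using Suc unfolding d_def by blast
    obtain a' b' where sub: "a' \<in> {a, a + (1 - lam) * d}" "b' \<in> {b, b + (1 - lam) * d}"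
      "hits k a' b' (lam * d)"
      using hits_sub[OF c d IH(3-7)] by blast
    have child: "cell z' (lam * d) \<and> c \<le> z' \<and> z' + lam * d \<le> 1"
      if "z' \<in> {z, z + (1 - lam) * d}" "cell z d" "c \<le> z" "z + d \<le> 1" for z z'
    proof -
      have "lam * d \<le> d" "0 \<le> (1 - lam) * d" "(1 - lam) * d + lam * d = d"
        using d lam_pos lam_less_half by (auto simp: algebra_simps)
      then show ?thesis using that cell_sub[of z d] by auto
    qed
    have "lam ^ Suc n * l = lam * d" by (simp add: d_def)
    then show ?case
      using child[OF sub(1) IH(1,3,5)] child[OF sub(2) IH(2,4,6)] sub(3) by metis
  qed
  \<comment> \<open>Cutting off at \<open>c > 0\<close> keeps the denominators away from 0, so an
    exact zero of \<open>x^2 - k * y\<close> found by compactness gives a quotient.\<close>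
  define G where "G = F \<inter> {c..}"
  have "compact G"
    unfolding G_def using compact_F by (intro compact_Int_closed) auto
  then have "compact (F \<times> G)" using compact_F by (intro compact_Times)
  moreover have "continuous_on (F \<times> G) (\<lambda>z. \<bar>(fst z)^2 - k * snd z\<bar>)"
    by (intro continuous_intros)
  moreover have "F \<times> G \<noteq> {}"
    using ex[of 0] cell_left_endpoint unfolding G_def by blast
  ultimately obtain z where z: "z \<in> F \<times> G"
    and z_min: "\<And>w. w \<in> F \<times> G \<Longrightarrow> \<bar>(fst z)^2 - k * snd z\<bar> \<le> \<bar>(fst w)^2 - k * snd w\<bar>"
    using continuous_attains_inf[of "F \<times> G" "\<lambda>z. \<bar>(fst z)^2 - k * snd z\<bar>"] by blast
  have k_nonneg: "0 \<le> k"
  proof -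
    have "0 \<le> k * (b + l)" using hit zero_le_power2[of a] unfolding hits_def by linarith
    then show ?thesis using ab c_pos l by (simp add: zero_le_mult_iff)
  qed
  \<comment> \<open>The left endpoints of the level-\<open>n\<close> cells are competitors for the
    minimum. The 3 comes from \<open>(a + d)^2 - a^2 = d * (2 * a + d) <= 3 * d\<close>.\<close>
  have "\<bar>(fst z)^2 - k * snd z\<bar> \<le> lam ^ n * (l * (k + 3))" for n
  proof -
    define d where "d = lam ^ n * l"
    have d: "0 < d" using l lam_pos by (simp add: d_def)
    obtain a b where ab: "cell a d" "cell b d" "c \<le> a" "c \<le> b" "a + d \<le> 1" "b + d \<le> 1"
      "hits k a b d"
      using ex[of n] unfolding d_def by blast
    have "(a + d)^2 \<le> a^2 + 3 * d"
    proof -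
      have "d * (2 * a + d) \<le> d * 3" using d ab c_pos by (intro mult_left_mono) auto
      then show ?thesis by (simp add: power2_eq_square algebra_simps)
    qed
    moreover have "0 \<le> d * k" using d k_nonneg by simp
    moreover have "d * (k + 3) = d * k + 3 * d" "k * (b + d) = k * b + d * k"
      by (simp_all add: algebra_simps)
    ultimately have "\<bar>a^2 - k * b\<bar> \<le> d * (k + 3)"
      using ab(7) d unfolding hits_def by linarith
    moreover have "(a, b) \<in> F \<times> G" using ab cell_left_endpoint by (auto simp: G_def)
    ultimately show ?thesis using z_min[of "(a, b)"] by (simp add: d_def mult.assoc)
  qed
  then have "\<bar>(fst z)^2 - k * snd z\<bar> \<le> 0 * (l * (k + 3))"
    by (intro LIMSEQ_le_const[OF tendsto_mult[OF lam_power_tendsto_0 tendsto_const]]) auto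
  then have "(fst z)^2 = k * snd z" by simp
  moreover have "fst z \<in> F" "snd z \<in> F" "0 < snd z" using z c_pos by (auto simp: G_def)
  ultimately have "k = (fst z)^2 / snd z" "fst z \<in> F" "snd z \<in> F" "snd z \<noteq> 0" by auto
  then show ?thesis unfolding quotset_def by blast
qed

text \<open>Both variables start in the cell with hull \<open>[1 - l, 1]\<close>, and
  \<open>c\<close> is its left end; the interval is the full range of \<open>x^2 / y\<close> over
  this hull.\<close>

lemma interval_subset_quotset:
  assumes "2 * (1 - 2 * lam) \<le> 1 - l" "1 - 2 * lam \<le> 2 * lam * (1 - l)"
    and l: "0 < l" "l < 1" and cell: "cell (1 - l) l"
  shows "{(1 - l)^2 .. 1 / (1 - l)} \<subseteq> quotset lam"
proof
  fix k assume "k \<in> {(1 - l)^2 .. 1 / (1 - l)}"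
  then have "hits k (1 - l) (1 - l) l" using l by (auto simp: hits_def field_simps)
  then show "k \<in> quotset lam"
    using hits_imp_quotset[OF assms(1,2) l(1) cell cell] by simp
qed

lemma cell_upper: "cell (1 - lam) lam"
  using F_upper by (simp add: cell_def add.commute)

lemma cell_upper_upper: "cell (1 - lam^2) (lam^2)"
  using cell_sub(2)[OF cell_upper] by (simp add: power2_eq_square algebra_simps)

section \<open>Scaling invariance and the two parameter ranges\<close>

text \<open>Shrinking \<open>y\<close> divides the quotient by \<open>lam\<close>. Shrinking
  \<open>x\<close> multiplies it by \<open>lam^2\<close>, and one division then leaves the factor
  \<open>lam\<close>.\<close>

lemma quotset_scale:
  assumes "k \<in> quotset lam"
  shows "lam * k \<in> quotset lam" "k / lam \<in> quotset lam"
proof -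
  have down: "k / lam \<in> quotset lam" if k: "k \<in> quotset lam" for k
  proof -
    obtain x y where "k = x^2 / y" "x \<in> F" "y \<in> F" "y \<noteq> 0"
      using k unfolding quotset_def by blast
    then have "k / lam = x^2 / (lam * y)" "x \<in> F" "lam * y \<in> F" "lam * y \<noteq> 0"
      using F_lower lam_pos by auto
    then show ?thesis unfolding quotset_def by blast
  qed
  obtain x y where "k = x^2 / y" "x \<in> F" "y \<in> F" "y \<noteq> 0"
    using assms unfolding quotset_def by blast
  then have "lam * (lam * k) = (lam * x)^2 / y" "lam * x \<in> F" "y \<in> F" "y \<noteq> 0"
    using F_lower by (auto simp: power2_eq_square)
  then have "lam * (lam * k) \<in> quotset lam" unfolding quotset_def by blast
  from down[OF this] show "lam * k \<in> quotset lam" using lam_pos by simp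
  show "k / lam \<in> quotset lam" using down assms by blast
qed

lemma quotset_scale_power:
  "k \<in> quotset lam \<Longrightarrow> lam ^ n * k \<in> quotset lam \<and> k / lam ^ n \<in> quotset lam"
proof (induction n)
  case (Suc n)
  then show ?case
    using quotset_scale(1)[of "lam ^ n * k"] quotset_scale(2)[of "k / lam ^ n"]
    by (simp add: ac_simps)
qed simp

text \<open>
  Consecutive multiples of \<open>[p, q]\<close> by powers of \<open>\<lambda>\<close> overlap, so they cover the positive reals.
\<close>
lemma scaling_covers:
  assumes pq: "{p..q} \<subseteq> quotset lam" "0 < p" "p \<le> lam * q" and k: "0 < k"
  shows "k \<in> quotset lam"
proof -
  have below: "k \<in> quotset lam" if k: "0 < k" "k \<le> q" for k
  proof -
    have "q > 0" using k by simp
    then obtain n where n: "lam ^ n < k / q"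
      using ex_lam_power_less[of "k / q"] k by auto
    \<comment> \<open>Minimality places \<open>k\<close> in the half-open interval from
      \<open>lam ^ N * q\<close> to \<open>lam ^ (N - 1) * q\<close>, which
      \<open>p <= lam * q\<close> puts inside \<open>lam ^ (N - 1)\<close> times
      \<open>[p, q]\<close>.\<close>
    define N where "N = (LEAST n. lam ^ n * q < k)"
    have N: "lam ^ N * q < k"
      unfolding N_def by (rule LeastI[of _ n]) (use n \<open>q > 0\<close> in \<open>simp add: field_simps\<close>)
    then have "N \<noteq> 0" using k by (intro notI) simp
    then obtain M where M: "N = Suc M" by (cases N) auto
    then have "k \<le> lam ^ M * q"
      using not_less_Least[of M "\<lambda>n. lam ^ n * q < k"] unfolding N_def by auto
    have "lam ^ M * p \<le> lam ^ M * (lam * q)"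
      using pq lam_pos by (intro mult_left_mono) auto
    then have "lam ^ M * p \<le> k" using N M by (simp add: mult.assoc mult.left_commute)
    then have "k / lam ^ M \<in> {p..q}"
      using \<open>k \<le> lam ^ M * q\<close> lam_pos by (simp add: field_simps)
    then have "lam ^ M * (k / lam ^ M) \<in> quotset lam"
      using pq(1) quotset_scale_power by blast
    then show ?thesis using lam_pos by simp
  qed
  have "0 < lam * q" using pq by linarith
  then have "0 < q" using lam_pos by (simp add: zero_less_mult_iff)
  then obtain n where "lam ^ n < q / k"
    using ex_lam_power_less[of "q / k"] k by auto
  then have "lam ^ n * k \<in> quotset lam"
    using k lam_pos by (intro below) (auto simp: field_simps)
  then have "lam ^ n * k / lam ^ n \<in> quotset lam"
    using quotset_scale_power by blast
  then show ?thesis using lam_pos by simp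
qed

lemma quotset_eq_nonneg:
  assumes "1/3 \<le> lam"
  shows "quotset lam = {0..}"
proof
  show "quotset lam \<subseteq> {0..}"
    using F_nonneg by (auto simp: quotset_def)
  have "2/3 * (1/2) \<le> 2 * lam * (1 - lam)"
    using assms lam_less_half by (intro mult_mono) auto
  then have "1 - 2 * lam \<le> 2 * lam * (1 - lam)"
    using assms by simp
  then have int: "{(1 - lam)^2 .. 1 / (1 - lam)} \<subseteq> quotset lam"
    using assms lam_pos lam_less_half cell_upper by (intro interval_subset_quotset) auto
  \<comment> \<open>The overlap condition of \<open>scaling_covers\<close> for this interval is
    \<open>(1 - lam)^3 <= lam\<close>; at \<open>lam = 1/3\<close> it reads
    \<open>8/27 <= 1/3\<close>.\<close>
  have "(1 - lam)^3 \<le> (2/3)^3"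
    using assms lam_less_half by (intro power_mono) auto
  also have "\<dots> \<le> lam" using assms by (simp add: power3_eq_cube)
  finally have "(1 - lam)^2 \<le> lam * (1 / (1 - lam))"
    using lam_less_half by (simp add: field_simps power3_eq_cube power2_eq_square)
  then have "k \<in> quotset lam" if "0 < k" for k
    using scaling_covers[OF int _ _ that] lam_less_half by simp
  moreover have "0 \<in> quotset lam"
  proof -
    have "0 = 0^2 / (1::real)" "(1::real) \<noteq> 0" by simp_all
    then show ?thesis unfolding quotset_def using zero_in_F one_in_F by blast
  qed
  ultimately show "{0..} \<subseteq> quotset lam" by (auto simp: le_less)
qed

lemma quotset_contains_interval:
  assumes "(2 - sqrt 2) / 2 \<le> lam"
  shows "\<exists>a b. a < b \<and> {a..b} \<subseteq> quotset lam"
proof -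
  \<comment> \<open>The rational bound \<open>lam >= 29/100\<close> suffices for both overlap
    conditions with \<open>c = 1 - lam^2\<close>.\<close>
  have "sqrt 2 \<le> 1.42" by (rule real_le_lsqrt) (auto simp: power2_eq_square)
  then have lam: "29/100 \<le> lam" using assms by simp
  have sq: "0 < lam^2" "lam^2 \<le> 1/4"
    using lam_pos lam_less_half power_mono[of lam "1/2" 2] by (auto simp: power2_eq_square)
  have "lam^2 \<le> lam * (1/2)"
    unfolding power2_eq_square using lam_pos lam_less_half by (intro mult_left_mono) auto
  then have c1: "2 * (1 - 2 * lam) \<le> 1 - lam^2"
    using lam by (simp add: algebra_simps)
  have "1 - 2 * lam \<le> 2 * lam * (3/4)" using lam by simp
  also have "\<dots> \<le> 2 * lam * (1 - lam^2)"
    using sq lam_pos by (intro mult_left_mono) auto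
  finally have c2: "1 - 2 * lam \<le> 2 * lam * (1 - lam^2)" .
  have "{(1 - lam^2)^2 .. 1 / (1 - lam^2)} \<subseteq> quotset lam"
    using c1 c2 sq cell_upper_upper by (intro interval_subset_quotset) auto
  moreover have "(1 - lam^2)^2 < 1" "1 < 1 / (1 - lam^2)"
    using sq power_less_one_iff[of "1 - lam^2" 2] by auto
  ultimately show ?thesis by (meson less_trans)
qed

end

theorem theorem1p1:
  fixes lam :: real
  assumes "0 < lam" and "lam < 1/2"
  shows "\<not> self_similar ((\<lambda>x. x^2) ` cantor lam)
    \<and> (1/3 \<le> lam \<longrightarrow> Kset lam = {} \<and> quotset lam = {0..})
    \<and> ((2 - sqrt 2) / 2 \<le> lam \<longrightarrow> (\<exists>a b. a < b \<and> {a..b} \<subseteq> quotset lam))"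
proof -
  interpret cantor_ratio lam using assms by unfold_locales
  show ?thesis
    using square_not_self_similar quotset_eq_nonneg quotset_contains_interval
    by (auto simp: Kset_def)
qed

end
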